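(* Let $d\ge 1$ be an integer, let $\alpha>d$, and let $(W_x)_{x\in\mathbb{Z}^d}$ be i.i.d. non-negative random variables, distributed as $W$. Assume that there exist $\tau>1$ and $c>0$ such that $$\mathbb{P}(W>x)\le c\,x^{-(\tau-1)}\quad\text{for all } x>0,$$ with $\gamma:=\alpha(\tau-1)/d>2$. Then, for the random graph with edge probabilities $p_{xy}=1-\exp\{-\lambda W_xW_y/|x-y|^{\alpha}\}$, $\theta(\lambda)=0$ for all sufficiently small $\lambda>0$, that is, $\lambda_c>0$.
   Context: For $\lambda>0$, the random graph has vertex set $\mathbb{Z}^d$; conditionally on the weights $(W_x)_{x\in\mathbb{Z}^d}$, the edges between distinct vertices $x,y$ are independently present (occupied) with probability $p_{xy}=1-\exp\{-\lambda W_xW_y/|x-y|^{\alpha}\}$, where $|\cdot|$ is the Euclidean norm. The component $\mathcal{C}(0)$ is the set of vertices connected to $0$ by a path of occupied edges. The percolation probability is $\theta(\lambda)=\mathbb{P}(|\mathcal{C}(0)|=\infty)$, and the critical percolation value is $\lambda_c=\inf\{\lambda>0:\theta(\lambda)>0\}$, with $\inf\emptyset=\infty$; here $\alpha$ and the weight distribution are fixed. Standing normalization: if the weights have finite mean, they are normalized so that $\mathbb{E}[W]=1$ (for non-degenerate weights this amounts only to rescaling $\lambda$). *)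

theory Defs
  imports "HOL-Probability.Probability"
begin

text \<open>
  The lattice \<open>\<int>\<^sup>d\<close> is the type \<open>int ^ 'd\<close> with \<open>d = CARD('d)\<close>. There is no norm on
  \<open>int ^ 'd\<close> in the library, so distances are taken after embedding into \<open>real ^ 'd\<close>.
  The edge density parameter lambda is called \<open>l\<close> throughout.
\<close>

definition lattice_dist :: "int ^ 'd::finite \<Rightarrow> int ^ 'd \<Rightarrow> real" where
  "lattice_dist x y = norm ((\<chi> i. real_of_int (x $ i - y $ i)) :: real ^ 'd)"

definition conn_prob ::
    "real \<Rightarrow> real \<Rightarrow> (int ^ 'd::finite \<Rightarrow> real) \<Rightarrow> int ^ 'd \<Rightarrow> int ^ 'd \<Rightarrow> real" where
  "conn_prob \<alpha> l w x y = 1 - exp (- (l * w x * w y / lattice_dist x y powr \<alpha>))"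

definition lattice_edges :: "(int ^ 'd::finite) set set" where
  "lattice_edges = {{x, y} | x y. x \<noteq> y}"

text \<open>
  Edges are unordered pairs; \<open>conn_prob\<close> is symmetric, so it descends to them
  (see \<open>edge_prob_doubleton\<close> below).
\<close>

definition edge_prob ::
    "real \<Rightarrow> real \<Rightarrow> (int ^ 'd::finite \<Rightarrow> real) \<Rightarrow> (int ^ 'd) set \<Rightarrow> real" where
  "edge_prob \<alpha> l w e = (THE p. \<exists>x y. x \<noteq> y \<and> e = {x, y} \<and> p = conn_prob \<alpha> l w x y)"

text \<open>
  The law of the edge configuration for given (deterministic) weights \<open>w\<close>: independent edges,
  edge \<open>e\<close> being occupied (value \<open>True\<close>) with probability \<open>edge_prob \<alpha> l w e\<close>.
\<close>

definition conditional_law ::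
    "real \<Rightarrow> real \<Rightarrow> (int ^ 'd::finite \<Rightarrow> real) \<Rightarrow> ((int ^ 'd) set \<Rightarrow> bool) measure" where
  "conditional_law \<alpha> l w =
     (\<Pi>\<^sub>M e\<in>lattice_edges. measure_pmf (bernoulli_pmf (edge_prob \<alpha> l w e)))"

text \<open>
  The law of the random graph: first sample the weights \<open>W\<close>, which live on the probability
  space \<open>M\<close>, then sample the edges according to the conditional law given these weights.
  The lemmas below show that the kernel is measurable, so that the bind is the genuine
  mixture and not a default value.
\<close>

definition graph_law ::
    "'a measure \<Rightarrow> (int ^ 'd::finite \<Rightarrow> 'a \<Rightarrow> real) \<Rightarrow> real \<Rightarrow> real \<Rightarrow> ((int ^ 'd) set \<Rightarrow> bool) measure" where
  "graph_law M W \<alpha> l = M \<bind> (\<lambda>\<omega>. conditional_law \<alpha> l (\<lambda>x. W x \<omega>))"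

definition component :: "((int ^ 'd::finite) set \<Rightarrow> bool) \<Rightarrow> int ^ 'd \<Rightarrow> (int ^ 'd) set" where
  "component G x = {y. (x, y) \<in> {(u, v). u \<noteq> v \<and> G {u, v}}\<^sup>*}"

definition percolation_prob ::
    "'a measure \<Rightarrow> (int ^ 'd::finite \<Rightarrow> 'a \<Rightarrow> real) \<Rightarrow> real \<Rightarrow> real \<Rightarrow> real" where
  "percolation_prob M W \<alpha> l =
     measure (graph_law M W \<alpha> l) {G \<in> space (graph_law M W \<alpha> l). infinite (component G 0)}"

text \<open>The infimum is taken in the extended reals, where the infimum of the empty set is \<open>\<infinity>\<close>.\<close>

definition critical_value ::
    "'a measure \<Rightarrow> (int ^ 'd::finite \<Rightarrow> 'a \<Rightarrow> real) \<Rightarrow> real \<Rightarrow> ereal" where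
  "critical_value M W \<alpha> = Inf {ereal l | l. 0 < l \<and> 0 < percolation_prob M W \<alpha> l}"

lemma lattice_dist_commute: "lattice_dist x y = lattice_dist y x"
  for x y :: "int ^ 'd::finite"
proof -
  have "((\<chi> i. real_of_int (x $ i - y $ i)) :: real ^ 'd) = - (\<chi> i. real_of_int (y $ i - x $ i))"
    by (simp add: vec_eq_iff)
  then show ?thesis
    unfolding lattice_dist_def by (metis norm_minus_cancel)
qed

lemma conn_prob_commute: "conn_prob \<alpha> l w x y = conn_prob \<alpha> l w y x"
  by (simp add: conn_prob_def lattice_dist_commute[of x y] mult.commute mult.left_commute)

lemma edge_prob_doubleton:
  assumes "x \<noteq> y"
  shows "edge_prob \<alpha> l w {x, y} = conn_prob \<alpha> l w x y"
  unfolding edge_prob_def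
  by (rule the_equality) (use assms in \<open>auto simp: doubleton_eq_iff conn_prob_commute\<close>)

lemma conn_prob_bounds:
  assumes "0 \<le> l" "0 \<le> w x" "0 \<le> w y"
  shows "0 \<le> conn_prob \<alpha> l w x y" "conn_prob \<alpha> l w x y \<le> 1"
  using assms by (auto simp: conn_prob_def)

lemma sets_conditional_law:
  "sets (conditional_law \<alpha> l w) = sets (\<Pi>\<^sub>M e\<in>lattice_edges. count_space (UNIV :: bool set))"
  unfolding conditional_law_def by (rule sets_PiM_cong) auto

lemma prob_space_conditional_law: "prob_space (conditional_law \<alpha> l w)"
  unfolding conditional_law_def
  by (intro prob_space_PiM) (simp add: measure_pmf.prob_space_axioms)

lemma measurable_conditional_law:
  fixes W :: "int ^ 'd::finite \<Rightarrow> 'a \<Rightarrow> real"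
  assumes [measurable]: "\<And>x. W x \<in> borel_measurable M"
  shows "(\<lambda>\<omega>. conditional_law \<alpha> l (\<lambda>x. W x \<omega>)) \<in>
    M \<rightarrow>\<^sub>M prob_algebra (\<Pi>\<^sub>M e\<in>lattice_edges. count_space UNIV)"
proof (rule measurable_prob_algebra_generated[OF sets_PiM Int_stable_prod_algebra
      prod_algebra_sets_into_space])
  fix A :: "((int ^ 'd) set \<Rightarrow> bool) set"
  assume "A \<in> prod_algebra lattice_edges (\<lambda>e. count_space UNIV)"
  then obtain J X where A: "A = prod_emb lattice_edges (\<lambda>e. count_space UNIV) J (Pi\<^sub>E J X)"
    and J: "finite J" "J \<subseteq> lattice_edges"
    by (rule prod_algebraE) auto
  have *: "emeasure (conditional_law \<alpha> l (\<lambda>x. W x \<omega>)) A =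
      (\<Prod>e\<in>J. emeasure (measure_pmf (bernoulli_pmf (edge_prob \<alpha> l (\<lambda>x. W x \<omega>) e))) (X e))" for \<omega>
  proof -
    interpret product_prob_space
      "\<lambda>e. measure_pmf (bernoulli_pmf (edge_prob \<alpha> l (\<lambda>x. W x \<omega>) e))" lattice_edges
      by unfold_locales
    have "A = prod_emb lattice_edges
        (\<lambda>e. measure_pmf (bernoulli_pmf (edge_prob \<alpha> l (\<lambda>x. W x \<omega>) e))) J (Pi\<^sub>E J X)"
      unfolding A prod_emb_def by simp
    then show ?thesis
      unfolding conditional_law_def using J by (simp add: emeasure_PiM_emb)
  qed
  have meas: "(\<lambda>\<omega>. emeasure (measure_pmf (bernoulli_pmf (edge_prob \<alpha> l (\<lambda>x. W x \<omega>) e))) Y)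
      \<in> borel_measurable M" if "e \<in> lattice_edges" for e Y
  proof -
    obtain x y where e: "e = {x, y}" "x \<noteq> y"
      using \<open>e \<in> lattice_edges\<close> unfolding lattice_edges_def by blast
    have pmf_eq: "pmf (bernoulli_pmf p) b =
        (if b then min 1 (max 0 p) else 1 - min 1 (max 0 p))" for p b
      by (simp add: bernoulli_pmf.rep_eq)
    have eq: "emeasure (measure_pmf (bernoulli_pmf p)) Y =
        ennreal (\<Sum>b\<in>Y. if b then min 1 (max 0 p) else 1 - min 1 (max 0 p))" for p
      by (subst emeasure_measure_pmf_finite) (simp, intro arg_cong[where f = ennreal] sum.cong refl pmf_eq)
    show ?thesis
      unfolding eq e(1) edge_prob_doubleton[OF e(2)] conn_prob_def by measurable
  qed
  show "(\<lambda>\<omega>. emeasure (conditional_law \<alpha> l (\<lambda>x. W x \<omega>)) A) \<in> borel_measurable M"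
    unfolding * using J by (intro borel_measurable_prod_ennreal meas) auto
qed (simp_all add: prob_space_conditional_law sets_conditional_law)

lemma
  fixes W :: "int ^ 'd::finite \<Rightarrow> 'a \<Rightarrow> real"
  assumes "prob_space M" "\<And>x. W x \<in> borel_measurable M"
  shows prob_space_graph_law: "prob_space (graph_law M W \<alpha> l)"
    and sets_graph_law:
      "sets (graph_law M W \<alpha> l) = sets (\<Pi>\<^sub>M e\<in>lattice_edges. count_space (UNIV :: bool set))"
    and emeasure_graph_law: "A \<in> sets (\<Pi>\<^sub>M e\<in>lattice_edges. count_space UNIV) \<Longrightarrow>
      emeasure (graph_law M W \<alpha> l) A =
        (\<integral>\<^sup>+\<omega>. emeasure (conditional_law \<alpha> l (\<lambda>x. W x \<omega>)) A \<partial>M)"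
proof -
  have M: "M \<in> space (prob_algebra M)"
    using assms(1) by (simp add: space_prob_algebra)
  note K = measurable_conditional_law[of W M \<alpha> l, OF assms(2)]
  show "prob_space (graph_law M W \<alpha> l)"
    unfolding graph_law_def by (rule prob_space_bind'[OF M K])
  show "sets (graph_law M W \<alpha> l) = sets (\<Pi>\<^sub>M e\<in>lattice_edges. count_space (UNIV :: bool set))"
    unfolding graph_law_def by (rule sets_bind'[OF M K])
  show "emeasure (graph_law M W \<alpha> l) A =
        (\<integral>\<^sup>+\<omega>. emeasure (conditional_law \<alpha> l (\<lambda>x. W x \<omega>)) A \<partial>M)"
    if "A \<in> sets (\<Pi>\<^sub>M e\<in>lattice_edges. count_space UNIV)"
    unfolding graph_law_def by (rule emeasure_bind_prob_algebra[OF M K that])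
qed

lemma infinite_component_measurable:
  fixes x :: "int ^ 'd::finite"
  shows "{G \<in> space (\<Pi>\<^sub>M e\<in>lattice_edges. count_space (UNIV :: bool set)). infinite (component G x)}
     \<in> sets (\<Pi>\<^sub>M e\<in>lattice_edges. count_space UNIV)"
proof -
  let ?P = "\<Pi>\<^sub>M e\<in>lattice_edges. count_space (UNIV :: bool set)"
  have edge: "Measurable.pred ?P (\<lambda>G. u \<noteq> v \<and> G {u, v})" for u v :: "int ^ 'd"
  proof (cases "u = v")
    case False
    then have "{u, v} \<in> lattice_edges" by (auto simp: lattice_edges_def)
    then have "(\<lambda>G. G {u, v}) \<in> measurable ?P (count_space UNIV)"
      by (rule measurable_component_singleton)
    with False show ?thesis by simp
  qed simp
  have path: "Measurable.pred ?P (\<lambda>G. (x, y) \<in> {(u, v). u \<noteq> v \<and> G {u, v}} ^^ n)" for y n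
  proof (induction n arbitrary: y)
    case 0
    show ?case by simp
  next
    case (Suc n)
    have "((x, y) \<in> {(u, v). u \<noteq> v \<and> G {u, v}} ^^ Suc n) \<longleftrightarrow>
        (\<exists>z. (x, z) \<in> {(u, v). u \<noteq> v \<and> G {u, v}} ^^ n \<and> z \<noteq> y \<and> G {z, y})" for G
      by (auto simp: relcomp_unfold)
    moreover have "Measurable.pred ?P
        (\<lambda>G. \<exists>z. (x, z) \<in> {(u, v). u \<noteq> v \<and> G {u, v}} ^^ n \<and> z \<noteq> y \<and> G {z, y})"
      by (intro pred_intros_countable pred_intros_logic Suc.IH edge)
    ultimately show ?case by simp
  qed
  have comp: "Measurable.pred ?P (\<lambda>G. y \<in> component G x)" for y
    unfolding component_def mem_Collect_eq rtrancl_power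
    by (intro pred_intros_countable path)
  have fin: "finite (component G x) \<longleftrightarrow>
      (\<exists>n::nat. \<forall>y. y \<in> component G x \<longrightarrow> to_nat y \<le> n)" for G :: "(int ^ 'd) set \<Rightarrow> bool"
  proof
    assume "finite (component G x)"
    then have "finite (to_nat ` component G x)" by simp
    then show "\<exists>n. \<forall>y. y \<in> component G x \<longrightarrow> to_nat y \<le> n"
      by (auto simp: finite_nat_set_iff_bounded_le)
  next
    assume "\<exists>n. \<forall>y. y \<in> component G x \<longrightarrow> to_nat y \<le> n"
    then have "finite (to_nat ` component G x)"
      by (auto simp: finite_nat_set_iff_bounded_le)
    then show "finite (component G x)"
      by (rule finite_imageD) (auto simp: inj_on_def)
  qed
  have "Measurable.pred ?P (\<lambda>G. infinite (component G x))"
    unfolding fin by (intro pred_intros_countable pred_intros_logic comp) auto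
  then show ?thesis by (simp add: pred_def)
qed

end

theory Submission
  imports Defs
begin

text \<open>
  The proof is a first moment bound on self-avoiding open paths, made possible by weakening the
  connection probability to a fractional power of its exponent. Since
  \<open>1 - exp (- t) \<le> t powr r\<close> for \<open>t \<ge> 0\<close> and \<open>0 < r \<le> 1\<close>, an edge between \<open>x\<close> and \<open>y\<close> is present
  with conditional probability at most \<open>(l W\<^sub>x W\<^sub>y)\<^sup>r |x - y| powr (- \<alpha> r)\<close>
  (lemma \<open>conn_prob_le\<close>). Along a self-avoiding path every vertex lies on at most two edges, so the
  conditional probability that the whole path is open is at most the product of the factors
  \<open>l powr r * |x - y| powr (- \<alpha> r)\<close> of its edges times the product of \<open>(max 1 W\<^sub>x) powr (2 r)\<close> over its
  vertices. The latter product has independent factors; its expectation is \<open>k ^ n\<close>,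
  \<open>n\<close> being the number of vertices and \<open>k\<close> the expectation of \<open>(max 1 W\<^sub>0) powr (2 r)\<close>
  (lemma \<open>graph_law_open_path_le\<close>).

  Two requirements on \<open>r\<close> remain: \<open>2 r < \<tau> - 1\<close>, so that the tail bound makes \<open>k\<close> finite, and
  \<open>\<alpha> r > d\<close>, so that \<open>|x - y| powr (- \<alpha> r)\<close> is summable over \<open>y\<close>, with sums at most \<open>Z\<close>, say. Such an
  \<open>r \<le> 1\<close> exists exactly because \<open>\<alpha> > d\<close> and \<open>\<alpha> (\<tau> - 1) / d > 2\<close>.

  Summed over all paths of \<open>n\<close> edges that start at the origin, the probabilities are at most
  \<open>k * (l powr r * k * Z) ^ n\<close>. For small \<open>l\<close> this is a convergent geometric series, so by
  Borel-Cantelli almost surely only finitely many self-avoiding paths from the origin are open. Each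
  vertex of the component is the endpoint of one of them, hence the component is finite
  (lemma \<open>percolation_prob_eq_0\<close>).
\<close>

section \<open>Weights of paths\<close>

fun path_weight :: "('v \<Rightarrow> 'v \<Rightarrow> 'b::comm_monoid_mult) \<Rightarrow> 'v list \<Rightarrow> 'b" where
  "path_weight f (x # y # zs) = f x y * path_weight f (y # zs)"
| "path_weight f _ = 1"

fun path_edges :: "'v list \<Rightarrow> 'v set set" where
  "path_edges (x # y # zs) = insert {x, y} (path_edges (y # zs))"
| "path_edges _ = {}"

lemma path_weight_nonneg:
  fixes f :: "'v \<Rightarrow> 'v \<Rightarrow> real"
  assumes "\<And>x y. 0 \<le> f x y"
  shows "0 \<le> path_weight f xs"
  by (induction xs rule: path_edges.induct) (auto simp: assms)

lemma path_weight_mono: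
  fixes f g :: "'v \<Rightarrow> 'v \<Rightarrow> real"
  assumes "\<And>x y. 0 \<le> f x y" "\<And>x y. f x y \<le> g x y"
  shows "path_weight f xs \<le> path_weight g xs"
proof (induction xs rule: path_edges.induct)
  case (1 x y zs)
  have "0 \<le> g x y" using assms[of x y] by linarith
  with 1 show ?case
    by (auto intro!: mult_mono assms path_weight_nonneg)
qed auto

lemma path_weight_mult:
  "path_weight (\<lambda>x y. f x y * g x y) xs = path_weight f xs * path_weight g xs"
  by (induction xs rule: path_edges.induct) (auto simp: algebra_simps)

lemma path_weight_const: "path_weight (\<lambda>_ _. a) xs = a ^ (length xs - 1)"
  by (induction xs rule: path_edges.induct) auto

lemma finite_path_edges: "finite (path_edges xs)"
  by (induction xs rule: path_edges.induct) auto

lemma path_edges_subset: "e \<in> path_edges xs \<Longrightarrow> e \<subseteq> set xs"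
  by (induction xs rule: path_edges.induct) auto

lemma path_edges_append: "path_edges ys \<subseteq> path_edges (xs @ ys)"
proof (induction xs)
  case (Cons x xs)
  then show ?case by (cases "xs @ ys") auto
qed auto

text \<open>
  Distinctness of the vertices is what makes the edges of the path distinct; otherwise a repeated
  edge would contribute one factor on the left and several on the right.
\<close>

lemma prod_path_edges:
  assumes "distinct xs" "\<And>x y. x \<noteq> y \<Longrightarrow> h {x, y} = f x y"
  shows "(\<Prod>e\<in>path_edges xs. h e) = path_weight f xs"
  using assms(1)
proof (induction xs rule: path_edges.induct)
  case (1 x y zs)
  have "{x, y} \<notin> path_edges (y # zs)"
    using path_edges_subset[of "{x, y}" "y # zs"] 1(2) by auto
  with 1 show ?case
    by (simp add: finite_path_edges assms(2))
qed auto

text \<open>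
  Every vertex of a path lies on at most two of its edges, and exactly one if it is an end. The
  missing factors at the ends may be supplied because \<open>g \<ge> 1\<close>.
\<close>

lemma path_weight_vertices_le:
  fixes g :: "'v \<Rightarrow> real"
  assumes g: "\<And>x. 1 \<le> g x" and "distinct xs"
  shows "path_weight (\<lambda>x y. g x * g y) xs \<le> (\<Prod>x\<in>set xs. (g x)\<^sup>2)"
proof (cases xs)
  case Nil then show ?thesis by simp
next
  case (Cons x xs')
  have g0: "0 \<le> g x" for x using g[of x] by linarith
  \<comment> \<open>The extra factor \<open>g x\<close> stands for an edge that enters the path at \<open>x\<close>; it makes the induction on the path work.\<close>
  have "g x * path_weight (\<lambda>x y. g x * g y) (x # xs') \<le> (\<Prod>x\<in>set (x # xs'). (g x)\<^sup>2)"
    if "distinct (x # xs')"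
    using that
  proof (induction xs' arbitrary: x)
    case Nil
    show ?case using g[of x] g0[of x] by (simp add: power2_eq_square mult_left_mono)
  next
    case (Cons y ys)
    have "g x * path_weight (\<lambda>x y. g x * g y) (x # y # ys) =
        (g x)\<^sup>2 * (g y * path_weight (\<lambda>x y. g x * g y) (y # ys))"
      by (simp add: power2_eq_square algebra_simps)
    also have "\<dots> \<le> (g x)\<^sup>2 * (\<Prod>x\<in>set (y # ys). (g x)\<^sup>2)"
      by (intro mult_left_mono Cons.IH) (use Cons.prems in auto)
    also have "\<dots> = (\<Prod>x\<in>set (x # y # ys). (g x)\<^sup>2)"
      using Cons.prems by (subst prod.insert[symmetric]) auto
    finally show ?case .
  qed
  moreover have "path_weight (\<lambda>x y. g x * g y) xs \<le> g x * path_weight (\<lambda>x y. g x * g y) xs"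
    using mult_right_mono[OF g[of x] path_weight_nonneg[of "\<lambda>x y. g x * g y" xs]] g0 by simp
  ultimately show ?thesis using Cons assms(2) by auto
qed

section \<open>Summation over paths\<close>

text \<open>
  Summing out the last vertices one after the other costs a factor \<open>S\<close> each. Only finitely many
  vertices are admitted so that the sums are finite; the bound does not depend on them.
\<close>

lemma sum_path_weight_le:
  fixes w :: "'v \<Rightarrow> 'v \<Rightarrow> real"
  assumes w: "\<And>x y. 0 \<le> w x y" and B: "finite B"
    and S: "\<And>x. (\<Sum>y\<in>B. w x y) \<le> S"
  shows "(\<Sum>xs | set xs \<subseteq> B \<and> length xs = n. path_weight w (x # xs)) \<le> S ^ n"
proof (induction n arbitrary: x)
  case 0
  have "{xs. set xs \<subseteq> B \<and> length xs = 0} = {[]}" by auto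
  then show ?case by simp
next
  case (Suc n)
  let ?L = "{xs. set xs \<subseteq> B \<and> length xs = n}"
  have S0: "0 \<le> S" using order_trans[OF sum_nonneg S] w by blast
  have eq: "{xs. set xs \<subseteq> B \<and> length xs = Suc n} = (\<lambda>(y, ys). y # ys) ` (B \<times> ?L)"
    by (auto simp: image_iff length_Suc_conv)
  have "(\<Sum>xs | set xs \<subseteq> B \<and> length xs = Suc n. path_weight w (x # xs)) =
      (\<Sum>(y, ys)\<in>B \<times> ?L. w x y * path_weight w (y # ys))"
    unfolding eq by (subst sum.reindex) (auto simp: inj_on_def case_prod_unfold)
  also have "\<dots> = (\<Sum>y\<in>B. w x y * (\<Sum>ys\<in>?L. path_weight w (y # ys)))"
    by (simp add: sum.cartesian_product sum_distrib_left)
  also have "\<dots> \<le> (\<Sum>y\<in>B. w x y * S ^ n)"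
    by (intro sum_mono mult_left_mono Suc.IH w)
  also have "\<dots> = (\<Sum>y\<in>B. w x y) * S ^ n" by (simp add: sum_distrib_right)
  also have "\<dots> \<le> S ^ Suc n" using S S0 by (simp add: mult_right_mono)
  finally show ?case .
qed

text \<open>
  The paths from \<open>x\<close>, of all lengths together, have total weight at most the geometric series in \<open>S\<close>.
\<close>

lemma path_weight_summable:
  fixes w :: "'v \<Rightarrow> 'v \<Rightarrow> real"
  assumes w: "\<And>x y. 0 \<le> w x y" and S: "\<And>x B. finite B \<Longrightarrow> (\<Sum>y\<in>B. w x y) \<le> S"
    and "S < 1"
  shows "(\<lambda>xs. path_weight w (x # xs)) summable_on UNIV"
proof (rule nonneg_bdd_above_summable_on)
  show "bdd_above (sum (\<lambda>xs. path_weight w (x # xs)) ` {F. F \<subseteq> UNIV \<and> finite F})"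
  proof (rule bdd_aboveI2)
    fix F :: "'v list set"
    assume "F \<in> {F. F \<subseteq> UNIV \<and> finite F}"
    then have F: "finite F" by simp
    define B where "B = (\<Union>xs\<in>F. set xs)"
    define N where "N = Max (insert 0 (length ` F))"
    have B: "finite B" unfolding B_def using F by auto
    have S0: "0 \<le> S" using S[of "{}"] by simp
    let ?L = "\<lambda>n. {xs. set xs \<subseteq> B \<and> length xs = n}"
    have "F \<subseteq> (\<Union>n\<le>N. ?L n)"
      unfolding B_def N_def using F by (auto intro!: Max_ge)
    then have "(\<Sum>xs\<in>F. path_weight w (x # xs)) \<le> (\<Sum>xs\<in>(\<Union>n\<le>N. ?L n). path_weight w (x # xs))"
      using B by (intro sum_mono2 path_weight_nonneg w) (auto intro: finite_lists_length_eq)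
    also have "\<dots> = (\<Sum>n\<le>N. \<Sum>xs\<in>?L n. path_weight w (x # xs))"
      using B by (intro sum.UNION_disjoint) (auto intro: finite_lists_length_eq)
    also have "\<dots> \<le> (\<Sum>n\<le>N. S ^ n)"
      by (intro sum_mono sum_path_weight_le w B S)
    also have "\<dots> \<le> (\<Sum>n. S ^ n)"
      using S0 \<open>S < 1\<close> by (intro sum_le_suminf) auto
    finally show "(\<Sum>xs\<in>F. path_weight w (x # xs)) \<le> (\<Sum>n. S ^ n)" .
  qed
qed (auto intro: path_weight_nonneg w)

section \<open>Components and self-avoiding paths\<close>

text \<open>
  A walk is built backwards from its end. When it is extended by a vertex that it already visits, the
  loop between the two visits is cut out, which leaves a suffix of the old path.
\<close>

lemma component_open_path:
  assumes "y \<in> component G x"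
  shows "\<exists>xs. distinct (x # xs) \<and> last (x # xs) = y \<and> (\<forall>e\<in>path_edges (x # xs). G e)"
proof -
  have "(x, y) \<in> {(u, v). u \<noteq> v \<and> G {u, v}}\<^sup>*"
    using assms by (simp add: component_def)
  then show ?thesis
  proof (induction rule: converse_rtrancl_induct)
    case base
    show ?case by (rule exI[of _ "[]"]) simp
  next
    case (step u v)
    then obtain xs where xs: "distinct (v # xs)" "last (v # xs) = y"
        "\<forall>e\<in>path_edges (v # xs). G e" and uv: "u \<noteq> v" "G {u, v}"
      by auto
    show ?case
    proof (cases "u \<in> set xs")
      case True
      then obtain as bs where ab: "xs = as @ u # bs" by (auto simp: in_set_conv_decomp)
      have "path_edges (u # bs) \<subseteq> path_edges (v # xs)"
        using path_edges_append[of "u # bs" "v # as"] ab by simp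
      then show ?thesis using xs ab by (intro exI[of _ bs]) (auto split: if_splits)
    next
      case False
      then show ?thesis using xs uv by (intro exI[of _ "v # xs"]) auto
    qed
  qed
qed

lemma finite_component_if_finitely_many_open_paths:
  assumes "finite {xs. distinct (x # xs) \<and> (\<forall>e\<in>path_edges (x # xs). G e)}" (is "finite ?P")
  shows "finite (component G x)"
proof (rule finite_subset)
  show "component G x \<subseteq> (\<lambda>xs. last (x # xs)) ` ?P"
    using component_open_path[of _ G x] by fastforce
  show "finite ((\<lambda>xs. last (x # xs)) ` ?P)" using assms by simp
qed

section \<open>Summability over the lattice\<close>

lemma int_powr_sums_bounded:
  assumes "1 < b"
  shows "\<exists>C\<ge>0. \<forall>F::int set. finite F \<longrightarrow> (\<Sum>k\<in>F. max 1 \<bar>real_of_int k\<bar> powr (- b)) \<le> C"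
proof -
  let ?f = "\<lambda>k::int. max 1 \<bar>real_of_int k\<bar> powr (- b)"
  have "summable (\<lambda>n. real n powr (- b))"
    using assms by (simp add: summable_real_powr_iff)
  then have "summable (\<lambda>n. ?f (int n))"
    by (subst summable_cong[where g = "\<lambda>n. real n powr (- b)"])
      (auto intro!: eventually_mono[OF eventually_ge_at_top[of 1]] simp: max_def)
  then have s: "(\<Sum>n\<in>N. ?f (int n)) \<le> (\<Sum>n. ?f (int n))" if "finite N" for N
    using that by (intro sum_le_suminf) auto
  have "(\<Sum>k\<in>F. ?f k) \<le> 2 * (\<Sum>n. ?f (int n))" if "finite F" for F
  proof -
    let ?N = "nat ` abs ` F"
    have N: "finite ?N" using that by simp
    have "(\<Sum>k\<in>F. ?f k) \<le> (\<Sum>k\<in>int ` ?N \<union> (\<lambda>n. - int n) ` ?N. ?f k)"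
    proof (intro sum_mono2)
      show "F \<subseteq> int ` ?N \<union> (\<lambda>n. - int n) ` ?N"
      proof
        fix k assume "k \<in> F"
        then have "nat \<bar>k\<bar> \<in> ?N" by blast
        moreover have "k = int (nat \<bar>k\<bar>) \<or> k = - int (nat \<bar>k\<bar>)" by linarith
        ultimately show "k \<in> int ` ?N \<union> (\<lambda>n. - int n) ` ?N" by blast
      qed
    qed (use N in auto)
    also have "\<dots> \<le> (\<Sum>k\<in>int ` ?N. ?f k) + (\<Sum>k\<in>(\<lambda>n. - int n) ` ?N. ?f k)"
      using N by (subst sum_Un) (auto intro!: sum_nonneg)
    also have "\<dots> = 2 * (\<Sum>n\<in>?N. ?f (int n))"
      by (simp add: sum.reindex inj_on_def)
    also have "\<dots> \<le> 2 * (\<Sum>n. ?f (int n))" using s[OF N] by simp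
    finally show ?thesis .
  qed
  moreover have "0 \<le> 2 * (\<Sum>n. ?f (int n))" using s[of "{}"] by simp
  ultimately show ?thesis by blast
qed

text \<open>
  The Euclidean distance of distinct lattice points is at least \<open>1\<close> and at least each coordinate
  difference, so the power can be split into \<open>d\<close> equal factors, one for each coordinate. This reduces
  summability over the lattice to summability over the integers. For \<open>x = y\<close> the left-hand side is
  \<open>0\<close>, since \<open>0 powr a = 0\<close>.
\<close>

lemma lattice_powr_le_prod:
  fixes x y :: "int ^ 'd::finite"
  assumes "0 \<le> b"
  shows "lattice_dist x y powr (- (b * real CARD('d)))
    \<le> (\<Prod>i\<in>UNIV. max 1 \<bar>real_of_int (x $ i - y $ i)\<bar> powr (- b))"
proof (cases "x = y")
  case True
  then have "lattice_dist x y = 0" by (simp add: lattice_dist_def zero_vec_def[symmetric])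
  then show ?thesis by (simp add: prod_nonneg)
next
  case False
  have comp: "\<bar>real_of_int (x $ i - y $ i)\<bar> \<le> lattice_dist x y" for i
    using component_le_norm_cart[of "(\<chi> i. real_of_int (x $ i - y $ i)) :: real ^ 'd" i]
    by (simp add: lattice_dist_def)
  obtain i where "x $ i \<noteq> y $ i" using False by (auto simp: vec_eq_iff)
  then have "1 \<le> \<bar>real_of_int (x $ i - y $ i)\<bar>" by linarith
  with comp[of i] have D: "1 \<le> lattice_dist x y" by linarith
  have "lattice_dist x y powr (- (b * real CARD('d))) = (\<Prod>i\<in>(UNIV::'d set). lattice_dist x y powr (- b))"
    using D by (simp add: powr_realpow[symmetric] powr_powr)
  also have "\<dots> \<le> (\<Prod>i\<in>UNIV. max 1 \<bar>real_of_int (x $ i - y $ i)\<bar> powr (- b))"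
    using D comp assms by (intro prod_mono conjI powr_mono2') auto
  finally show ?thesis .
qed

text \<open>
  The sum over a finite set of lattice points is enlarged to a box, where the sum of the products
  from the preceding lemma factorizes.
\<close>

lemma lattice_powr_sums_bounded:
  assumes "real CARD('d::finite) < \<beta>"
  shows "\<exists>Z\<ge>0. \<forall>(x :: int ^ 'd) B. finite B \<longrightarrow> (\<Sum>y\<in>B. lattice_dist x y powr (- \<beta>)) \<le> Z"
proof -
  define b where "b = \<beta> / real CARD('d)"
  have b: "1 < b" "\<beta> = b * real CARD('d)" using assms by (auto simp: b_def)
  obtain C where C: "0 \<le> C"
    "\<And>F::int set. finite F \<Longrightarrow> (\<Sum>k\<in>F. max 1 \<bar>real_of_int k\<bar> powr (- b)) \<le> C"
    using int_powr_sums_bounded[OF b(1)] by blast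
  have "(\<Sum>y\<in>B. lattice_dist x y powr (- \<beta>)) \<le> C ^ CARD('d)" if B: "finite B"
    for x :: "int ^ 'd" and B
  proof -
    define h where "h y = (\<lambda>i. x $ i - y $ i)" for y
    define F where "F = (\<Union>y\<in>B. range (h y))"
    have F: "finite F" using B by (auto simp: F_def)
    have inj: "inj_on h B" by (auto simp: inj_on_def h_def vec_eq_iff fun_eq_iff)
    have hB: "h ` B \<subseteq> (UNIV \<rightarrow>\<^sub>E F)" by (auto simp: F_def)
    have "(\<Sum>y\<in>B. lattice_dist x y powr (- \<beta>)) \<le>
        (\<Sum>y\<in>B. \<Prod>i\<in>UNIV. max 1 \<bar>real_of_int (h y i)\<bar> powr (- b))"
      unfolding b(2) h_def using b(1) by (intro sum_mono lattice_powr_le_prod) simp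
    also have "\<dots> = (\<Sum>g\<in>h ` B. \<Prod>i\<in>UNIV. max 1 \<bar>real_of_int (g i)\<bar> powr (- b))"
      by (simp add: sum.reindex[OF inj])
    also have "\<dots> \<le> (\<Sum>g\<in>(UNIV::'d set) \<rightarrow>\<^sub>E F. \<Prod>i\<in>UNIV. max 1 \<bar>real_of_int (g i)\<bar> powr (- b))"
      using F hB by (intro sum_mono2) (auto intro!: prod_nonneg finite_PiE)
    also have "\<dots> = (\<Prod>i\<in>(UNIV::'d set). \<Sum>k\<in>F. max 1 \<bar>real_of_int k\<bar> powr (- b))"
      using F by (subst prod_sum_PiE) auto
    also have "\<dots> \<le> (\<Prod>i\<in>(UNIV::'d set). C)"
      by (intro prod_mono conjI sum_nonneg C(2) F powr_ge_zero)
    finally show ?thesis by simp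
  qed
  then show ?thesis using C(1) by (intro exI[of _ "C ^ CARD('d)"]) auto
qed

section \<open>Moments, connection probabilities and Borel-Cantelli\<close>

text \<open>
  A dyadic decomposition: on the event \<open>2 ^ k < X \<le> 2 ^ Suc k\<close> the integrand is at most
  \<open>(2 ^ Suc k) powr s\<close>, and by the tail bound these contributions are dominated by a geometric series of
  ratio \<open>2 powr (s - a) < 1\<close>.
\<close>

lemma (in prob_space) nn_integral_powr_finite_if_tail:
  fixes X :: "'a \<Rightarrow> real"
  assumes [measurable]: "X \<in> borel_measurable M" and "0 \<le> s" "s < a" "0 \<le> c"
    and tail: "\<And>t. t > 0 \<Longrightarrow> prob {\<omega> \<in> space M. X \<omega> > t} \<le> c * t powr (- a)"
  shows "(\<integral>\<^sup>+\<omega>. ennreal (max 1 (X \<omega>) powr s) \<partial>M) < \<infinity>"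
proof -
  define E where "E k = {\<omega> \<in> space M. X \<omega> > 2 ^ k}" for k :: nat
  have [measurable]: "E k \<in> sets M" for k by (simp add: E_def)
  let ?u = "\<lambda>k. ennreal ((2 ^ Suc k) powr s)"
  have pt: "ennreal (max 1 (X \<omega>) powr s) \<le> 1 + (\<Sum>k. ?u k * indicator (E k) \<omega>)"
    if \<omega>: "\<omega> \<in> space M" for \<omega>
  proof (cases "X \<omega> \<le> 1")
    case True
    then show ?thesis by (simp add: max_absorb1)
  next
    case False
    obtain n where "X \<omega> < 2 ^ n" using real_arch_pow[of 2 "X \<omega>"] by auto
    then have ex: "\<exists>n. X \<omega> \<le> 2 ^ n" using less_imp_le by blast
    define m where "m = (LEAST n. X \<omega> \<le> 2 ^ n)"
    have m: "X \<omega> \<le> 2 ^ m" using LeastI_ex[OF ex] by (simp add: m_def)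
    then obtain k where k: "m = Suc k" using False by (cases m) auto
    have "\<not> X \<omega> \<le> 2 ^ k" using not_less_Least[of k "\<lambda>n. X \<omega> \<le> 2 ^ n"] k by (simp add: m_def)
    then have "\<omega> \<in> E k" using \<omega> by (simp add: E_def)
    have "ennreal (max 1 (X \<omega>) powr s) \<le> ?u k"
      using m k False \<open>0 \<le> s\<close> by (intro ennreal_leI powr_mono2) auto
    also have "\<dots> = (\<Sum>k\<in>{k}. ?u k * indicator (E k) \<omega>)" using \<open>\<omega> \<in> E k\<close> by simp
    also have "\<dots> \<le> (\<Sum>k. ?u k * indicator (E k) \<omega>)" by (intro sum_le_suminf) auto
    finally show ?thesis by (simp add: add_increasing)
  qed
  have dyadic: "?u k * emeasure M (E k) \<le> ennreal (c * 2 powr s * (2 powr (s - a)) ^ k)" for k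
  proof -
    have "?u k * emeasure M (E k) = ennreal ((2 ^ Suc k) powr s * prob (E k))"
      by (simp add: emeasure_eq_measure ennreal_mult)
    also have "\<dots> \<le> ennreal ((2 ^ Suc k) powr s * (c * (2 ^ k) powr (- a)))"
      unfolding E_def by (intro ennreal_leI mult_left_mono tail) auto
    also have "(2 ^ Suc k) powr s * (c * (2 ^ k) powr (- a)) = c * 2 powr s * (2 powr (s - a)) ^ k"
    proof -
      have "(2 ^ k) powr t = (2 powr t) ^ k" for t :: real
        by (simp add: powr_realpow[symmetric] powr_powr mult.commute)
      then show ?thesis
        by (simp add: powr_mult powr_diff powr_minus field_simps power_divide)
    qed
    finally show ?thesis .
  qed
  have "(\<integral>\<^sup>+\<omega>. ennreal (max 1 (X \<omega>) powr s) \<partial>M)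
      \<le> (\<integral>\<^sup>+\<omega>. 1 + (\<Sum>k. ?u k * indicator (E k) \<omega>) \<partial>M)"
    by (intro nn_integral_mono pt)
  also have "\<dots> = 1 + (\<Sum>k. ?u k * emeasure M (E k))"
    by (subst nn_integral_add) (auto simp: nn_integral_suminf nn_integral_cmult_indicator emeasure_space_1)
  also have "\<dots> \<le> 1 + (\<Sum>k. ennreal (c * 2 powr s * (2 powr (s - a)) ^ k))"
    by (intro add_left_mono suminf_le dyadic) auto
  also have "\<dots> < \<infinity>"
  proof -
    have "norm (2 powr (s - a)) < (1::real)" using \<open>s < a\<close> by (simp add: powr_less_one)
    then have "summable (\<lambda>k. c * 2 powr s * (2 powr (s - a)) ^ k)"
      by (intro summable_mult summable_geometric)
    then have "(\<Sum>k. ennreal (c * 2 powr s * (2 powr (s - a)) ^ k)) \<noteq> top"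
      using \<open>0 \<le> c\<close> by (intro ennreal_suminf_neq_top) auto
    then show ?thesis by (simp add: less_top)
  qed
  finally show ?thesis .
qed

lemma one_minus_exp_le_powr:
  fixes t r :: real
  assumes "0 \<le> t" "0 < r" "r \<le> 1"
  shows "1 - exp (- t) \<le> t powr r"
proof (cases "t \<le> 1")
  case True
  have "1 - exp (- t) \<le> t" using exp_ge_add_one_self[of "- t"] by simp
  also have "t \<le> t powr r"
    using powr_mono'[of r 1 t] assms True by (cases "t = 0") auto
  finally show ?thesis .
next
  case False
  then have "1 \<le> t powr r" using assms by (simp add: ge_one_powr_ge_zero)
  moreover have "1 - exp (- t) \<le> 1" by simp
  ultimately show ?thesis by linarith
qed

text \<open>
  Replacing the weights by their maximum with \<open>1\<close> gives vertex factors that are at least \<open>1\<close>, as needed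
  for bounding their product along a path. In the case \<open>x = y\<close> both sides are \<open>0\<close>, by the conventions
  \<open>a / 0 = 0\<close> and \<open>0 powr a = 0\<close>.
\<close>

lemma conn_prob_le:
  assumes "0 \<le> l" "\<And>x. 0 \<le> w x" "0 < r" "r \<le> 1"
  shows "conn_prob \<alpha> l w x y \<le>
    l powr r * lattice_dist x y powr (- (\<alpha> * r)) * (max 1 (w x) powr r * max 1 (w y) powr r)"
proof -
  let ?D = "lattice_dist x y"
  have D: "0 \<le> ?D" by (simp add: lattice_dist_def)
  have "conn_prob \<alpha> l w x y \<le> (l * w x * w y / ?D powr \<alpha>) powr r"
    unfolding conn_prob_def using assms by (intro one_minus_exp_le_powr) auto
  also have "\<dots> = l powr r * ?D powr (- (\<alpha> * r)) * (w x powr r * w y powr r)"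
    using assms D by (simp add: powr_mult powr_divide powr_powr powr_minus field_simps)
  also have "\<dots> \<le> l powr r * ?D powr (- (\<alpha> * r)) * (max 1 (w x) powr r * max 1 (w y) powr r)"
    using assms by (intro mult_left_mono mult_mono powr_mono2) auto
  finally show ?thesis .
qed

text \<open>
  The first Borel-Cantelli lemma for a family over an arbitrary countable index type, here the paths.
\<close>

lemma (in finite_measure) AE_finitely_many_events:
  fixes A :: "'i::countable \<Rightarrow> 'a set"
  assumes A: "\<And>i. A i \<in> sets M" and sum: "(\<lambda>i. measure M (A i)) summable_on UNIV"
  shows "AE x in M. finite {i. x \<in> A i}"
proof -
  \<comment> \<open>The family is spread over the natural numbers; those that are no code of an index get the empty event.\<close>
  define B where "B n = (if n \<in> range (to_nat :: 'i \<Rightarrow> nat) then A (from_nat n) else {})" for n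
  have "(\<lambda>n. measure M (B n)) summable_on range (to_nat :: 'i \<Rightarrow> nat)"
    using sum by (subst summable_on_reindex) (auto simp: B_def comp_def)
  then have "(\<lambda>n. measure M (B n)) summable_on UNIV"
    by (rule summable_on_cong_neutral[THEN iffD1, rotated -1]) (auto simp: B_def)
  then have "summable (\<lambda>n. measure M (B n))"
    by (subst (asm) summable_on_UNIV_nonneg_real_iff) auto
  then have "AE x in M. eventually (\<lambda>n. x \<in> space M - B n) sequentially"
    by (intro borel_cantelli_AE1) (auto simp: B_def A less_top[symmetric])
  then show ?thesis
  proof eventually_elim
    case (elim x)
    then obtain N where N: "\<And>n. n \<ge> N \<Longrightarrow> x \<notin> B n"
      by (auto simp: eventually_sequentially)
    have "to_nat ` {i. x \<in> A i} \<subseteq> {..<N}"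
    proof (intro image_subsetI)
      fix i assume "i \<in> {i. x \<in> A i}"
      then have "x \<in> B (to_nat i)" by (simp add: B_def)
      then show "to_nat i \<in> {..<N}" using N not_le by auto
    qed
    then have "finite (to_nat ` {i. x \<in> A i})" by (rule finite_subset) simp
    then show ?case by (rule finite_imageD) simp
  qed
qed

section \<open>The probability that a path is open\<close>

lemma path_edges_subset_lattice_edges: "distinct xs \<Longrightarrow> path_edges xs \<subseteq> lattice_edges"
  by (induction xs rule: path_edges.induct) (auto simp: lattice_edges_def)

lemma open_path_measurable:
  assumes "distinct xs"
  shows "{G \<in> space (\<Pi>\<^sub>M e\<in>lattice_edges. count_space (UNIV :: bool set)). \<forall>e\<in>path_edges xs. G e}
    \<in> sets (\<Pi>\<^sub>M e\<in>lattice_edges. count_space UNIV)"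
proof -
  let ?P = "\<Pi>\<^sub>M e\<in>lattice_edges. count_space (UNIV :: bool set)"
  have "Measurable.pred ?P (\<lambda>G. G e)" if "e \<in> path_edges xs" for e
    using path_edges_subset_lattice_edges[OF assms] that
    by (intro measurable_component_singleton) auto
  then have "Measurable.pred ?P (\<lambda>G. \<forall>e\<in>path_edges xs. G e)"
    by (intro pred_intros_finite finite_path_edges) auto
  then show ?thesis by (simp add: pred_def)
qed

lemma conditional_law_open_path:
  assumes "0 \<le> l" "\<And>x. 0 \<le> w x" "distinct xs"
  shows "emeasure (conditional_law \<alpha> l w)
      {G \<in> space (\<Pi>\<^sub>M e\<in>lattice_edges. count_space UNIV). \<forall>e\<in>path_edges xs. G e}
    = ennreal (path_weight (conn_prob \<alpha> l w) xs)"
proof -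
  let ?p = "edge_prob \<alpha> l w"
  interpret product_prob_space "\<lambda>e. measure_pmf (bernoulli_pmf (?p e))" lattice_edges
    by unfold_locales
  have p: "0 \<le> ?p e \<and> ?p e \<le> 1" if "e \<in> path_edges xs" for e
  proof -
    have "e \<in> lattice_edges" using path_edges_subset_lattice_edges[OF assms(3)] that by blast
    then obtain x y where "e = {x, y}" "x \<noteq> y" by (auto simp: lattice_edges_def)
    then show ?thesis using assms by (simp add: edge_prob_doubleton conn_prob_bounds)
  qed
  have "{G \<in> space (\<Pi>\<^sub>M e\<in>lattice_edges. count_space UNIV). \<forall>e\<in>path_edges xs. G e} =
      {G \<in> space (conditional_law \<alpha> l w). \<forall>e\<in>path_edges xs. G e \<in> {True}}"
    using sets_eq_imp_space_eq[OF sets_conditional_law[of \<alpha> l w]] by simp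
  also have "emeasure (conditional_law \<alpha> l w) \<dots> =
      (\<Prod>e\<in>path_edges xs. emeasure (measure_pmf (bernoulli_pmf (?p e))) {True})"
    unfolding conditional_law_def
    by (rule emeasure_PiM_Collect) (use path_edges_subset_lattice_edges[OF assms(3)] in
        \<open>auto simp: finite_path_edges\<close>)
  also have "\<dots> = (\<Prod>e\<in>path_edges xs. ennreal (?p e))"
    using p by (intro prod.cong refl) (simp add: emeasure_pmf_single)
  also have "\<dots> = ennreal (\<Prod>e\<in>path_edges xs. ?p e)"
    using p by (intro prod_ennreal) auto
  also have "(\<Prod>e\<in>path_edges xs. ?p e) = path_weight (conn_prob \<alpha> l w) xs"
    by (intro prod_path_edges assms edge_prob_doubleton)
  finally show ?thesis .
qed

lemma path_weight_conn_prob_le: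
  assumes "0 \<le> l" "\<And>x. 0 \<le> w x" "0 < r" "r \<le> 1" "distinct xs"
  shows "path_weight (conn_prob \<alpha> l w) xs \<le>
    path_weight (\<lambda>x y. l powr r * lattice_dist x y powr (- (\<alpha> * r))) xs *
    (\<Prod>x\<in>set xs. max 1 (w x) powr (2 * r))"
proof -
  let ?q = "\<lambda>x y. l powr r * lattice_dist x y powr (- (\<alpha> * r))"
  let ?g = "\<lambda>x. max 1 (w x) powr r"
  have "path_weight (conn_prob \<alpha> l w) xs \<le> path_weight (\<lambda>x y. ?q x y * (?g x * ?g y)) xs"
    using assms by (intro path_weight_mono conn_prob_le conn_prob_bounds) auto
  also have "\<dots> = path_weight ?q xs * path_weight (\<lambda>x y. ?g x * ?g y) xs"
    by (rule path_weight_mult)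
  also have "\<dots> \<le> path_weight ?q xs * (\<Prod>x\<in>set xs. (?g x)\<^sup>2)"
    using assms by (intro mult_left_mono path_weight_vertices_le path_weight_nonneg)
      (auto intro: ge_one_powr_ge_zero)
  also have "(\<Prod>x\<in>set xs. (?g x)\<^sup>2) = (\<Prod>x\<in>set xs. max 1 (w x) powr (2 * r))"
    by (simp add: power2_eq_square powr_add[symmetric])
  finally show ?thesis .
qed

text \<open>
  The one place where the randomness of the weights enters: after the edges have been integrated out,
  the vertices of the path contribute independent factors, each of expectation \<open>k\<close>.
\<close>

lemma graph_law_open_path_le:
  fixes W :: "int ^ 'd::finite \<Rightarrow> 'a \<Rightarrow> real"
  assumes M: "prob_space M"
    and indep: "prob_space.indep_vars M (\<lambda>_. borel) W UNIV"
    and ident: "\<And>x. distr M borel (W x) = distr M borel (W 0)"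
    and nonneg: "\<And>x \<omega>. \<omega> \<in> space M \<Longrightarrow> 0 \<le> W x \<omega>"
    and l: "0 \<le> l" and r: "0 < r" "r \<le> 1"
    and k: "0 \<le> k" "(\<integral>\<^sup>+\<omega>. ennreal (max 1 (W 0 \<omega>) powr (2 * r)) \<partial>M) = ennreal k"
    and xs: "distinct xs"
  shows "emeasure (graph_law M W \<alpha> l)
      {G \<in> space (\<Pi>\<^sub>M e\<in>lattice_edges. count_space UNIV). \<forall>e\<in>path_edges xs. G e}
    \<le> ennreal (path_weight (\<lambda>x y. l powr r * lattice_dist x y powr (- (\<alpha> * r))) xs
        * k ^ length xs)" (is "?lhs \<le> ennreal (path_weight ?q xs * _)")
proof -
  interpret prob_space M by (rule M)
  have [measurable]: "W x \<in> borel_measurable M" for x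
    using indep by (auto simp: indep_vars_def)
  let ?h = "\<lambda>t. ennreal (max 1 t powr (2 * r))"
  have "indep_vars (\<lambda>_. borel) (\<lambda>x \<omega>. ?h (W x \<omega>)) UNIV"
    by (rule indep_vars_compose2[OF indep]) measurable
  then have ind: "indep_vars (\<lambda>_. borel) (\<lambda>x \<omega>. ?h (W x \<omega>)) (set xs)"
    by (rule indep_vars_subset) auto
  have moment: "(\<integral>\<^sup>+\<omega>. ?h (W x \<omega>) \<partial>M) = ennreal k" for x
  proof -
    have "(\<integral>\<^sup>+\<omega>. ?h (W x \<omega>) \<partial>M) = (\<integral>\<^sup>+t. ?h t \<partial>distr M borel (W x))"
      by (subst nn_integral_distr) auto
    also have "\<dots> = (\<integral>\<^sup>+\<omega>. ?h (W 0 \<omega>) \<partial>M)"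
      unfolding ident[of x] by (subst nn_integral_distr) auto
    finally show ?thesis using k(2) by simp
  qed
  have q: "0 \<le> path_weight ?q xs" by (intro path_weight_nonneg) auto
  have "?lhs = (\<integral>\<^sup>+\<omega>. emeasure (conditional_law \<alpha> l (\<lambda>x. W x \<omega>))
      {G \<in> space (\<Pi>\<^sub>M e\<in>lattice_edges. count_space UNIV). \<forall>e\<in>path_edges xs. G e} \<partial>M)"
    by (rule emeasure_graph_law[OF M _ open_path_measurable[OF xs]]) measurable
  also have "\<dots> = (\<integral>\<^sup>+\<omega>. ennreal (path_weight (conn_prob \<alpha> l (\<lambda>x. W x \<omega>)) xs) \<partial>M)"
    by (intro nn_integral_cong conditional_law_open_path l nonneg xs)
  also have "\<dots> \<le> (\<integral>\<^sup>+\<omega>. ennreal (path_weight ?q xs) * (\<Prod>x\<in>set xs. ?h (W x \<omega>)) \<partial>M)"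
  proof (intro nn_integral_mono)
    fix \<omega> assume "\<omega> \<in> space M"
    then have "path_weight (conn_prob \<alpha> l (\<lambda>x. W x \<omega>)) xs \<le>
        path_weight ?q xs * (\<Prod>x\<in>set xs. max 1 (W x \<omega>) powr (2 * r))"
      by (intro path_weight_conn_prob_le l nonneg r xs)
    then show "ennreal (path_weight (conn_prob \<alpha> l (\<lambda>x. W x \<omega>)) xs)
        \<le> ennreal (path_weight ?q xs) * (\<Prod>x\<in>set xs. ?h (W x \<omega>))"
      using q by (simp add: prod_ennreal ennreal_mult[symmetric] prod_nonneg ennreal_leI)
  qed
  also have "\<dots> = ennreal (path_weight ?q xs) * (\<Prod>x\<in>set xs. \<integral>\<^sup>+\<omega>. ?h (W x \<omega>) \<partial>M)"
    by (subst nn_integral_cmult) (measurable, simp add: indep_vars_nn_integral[OF _ ind])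
  also have "\<dots> = ennreal (path_weight ?q xs * k ^ length xs)"
    using q k(1) xs by (simp add: moment distinct_card ennreal_mult ennreal_power)
  finally show ?thesis .
qed

section \<open>Absence of percolation\<close>

text \<open>
  A path with \<open>n\<close> edges has \<open>n + 1\<close> vertices. One factor \<open>k\<close> is therefore attached to each edge, which
  turns the bound on the path probability into \<open>k\<close> times a path weight whose kernel has row sums at
  most \<open>l powr r * (k * Z) < 1\<close>.
\<close>

lemma percolation_prob_eq_0:
  fixes W :: "int ^ 'd::finite \<Rightarrow> 'a \<Rightarrow> real"
  assumes M: "prob_space M"
    and indep: "prob_space.indep_vars M (\<lambda>_. borel) W UNIV"
    and ident: "\<And>x. distr M borel (W x) = distr M borel (W 0)"
    and nonneg: "\<And>x \<omega>. \<omega> \<in> space M \<Longrightarrow> 0 \<le> W x \<omega>"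
    and l: "0 \<le> l" and r: "0 < r" "r \<le> 1"
    and k: "0 \<le> k" "(\<integral>\<^sup>+\<omega>. ennreal (max 1 (W 0 \<omega>) powr (2 * r)) \<partial>M) = ennreal k"
    and Z: "\<And>(x :: int ^ 'd) B. finite B \<Longrightarrow> (\<Sum>y\<in>B. lattice_dist x y powr (- (\<alpha> * r))) \<le> Z"
    and small: "l powr r * (k * Z) < 1"
  shows "percolation_prob M W \<alpha> l = 0"
proof -
  let ?P = "\<Pi>\<^sub>M e\<in>(lattice_edges :: (int ^ 'd) set set). count_space (UNIV :: bool set)"
  let ?GL = "graph_law M W \<alpha> l"
  let ?q = "\<lambda>x y :: int ^ 'd. l powr r * lattice_dist x y powr (- (\<alpha> * r))"
  have W: "W x \<in> borel_measurable M" for x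
    using indep by (auto simp: prob_space.indep_vars_def[OF M])
  interpret GL: prob_space ?GL by (rule prob_space_graph_law[OF M W])
  have sets: "sets ?GL = sets ?P" by (rule sets_graph_law[OF M W])
  have space: "space ?GL = space ?P" by (rule sets_eq_imp_space_eq[OF sets])
  \<comment> \<open>A list \<open>xs\<close> stands for the path \<open>0 # xs\<close>, and lists that do not give a self-avoiding path get the empty event.\<close>
  define A where "A xs = (if distinct (0 # xs)
      then {G \<in> space ?P. \<forall>e\<in>path_edges (0 # xs). G e} else {})" for xs :: "(int ^ 'd) list"
  have A: "A xs \<in> sets ?GL" for xs
    unfolding A_def sets using open_path_measurable[of "0 # xs"] by auto
  have A_le: "measure ?GL (A xs) \<le> k * path_weight (\<lambda>x y. k * ?q x y) (0 # xs)" for xs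
  proof (cases "distinct (0 # xs)")
    case True
    have "emeasure ?GL (A xs) \<le> ennreal (path_weight ?q (0 # xs) * k ^ length (0 # xs))"
      unfolding A_def if_P[OF True]
      by (rule graph_law_open_path_le[OF M indep ident nonneg l r k True])
    then have "measure ?GL (A xs) \<le> path_weight ?q (0 # xs) * k ^ length (0 # xs)"
      using k(1) by (simp add: GL.emeasure_eq_measure path_weight_nonneg)
    also have "\<dots> = k * path_weight (\<lambda>x y. k * ?q x y) (0 # xs)"
      by (simp add: path_weight_mult path_weight_const)
    finally show ?thesis .
  next
    case False
    then show ?thesis using k(1) by (auto simp: A_def intro!: mult_nonneg_nonneg path_weight_nonneg)
  qed
  have "(\<lambda>xs. path_weight (\<lambda>x y. k * ?q x y) (0 # xs)) summable_on UNIV"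
  proof (rule path_weight_summable[OF _ _ small])
    fix x :: "int ^ 'd" and B :: "(int ^ 'd) set"
    assume "finite B"
    have "(\<Sum>y\<in>B. k * ?q x y) = l powr r * k * (\<Sum>y\<in>B. lattice_dist x y powr (- (\<alpha> * r)))"
      by (simp add: sum_distrib_left mult_ac)
    also have "\<dots> \<le> l powr r * k * Z"
      using k(1) Z[OF \<open>finite B\<close>] by (intro mult_left_mono) auto
    finally show "(\<Sum>y\<in>B. k * ?q x y) \<le> l powr r * (k * Z)" by (simp add: mult_ac)
  qed (use k(1) in auto)
  then have "(\<lambda>xs. k * path_weight (\<lambda>x y. k * ?q x y) (0 # xs)) summable_on UNIV"
    by (rule summable_on_cmult_right)
  then have "(\<lambda>xs. measure ?GL (A xs)) summable_on UNIV"
    by (rule summable_on_comparison_test) (use A_le in auto)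
  then have "AE G in ?GL. finite {xs. G \<in> A xs}"
    by (intro GL.AE_finitely_many_events A)
  then have "AE G in ?GL. \<not> infinite (component G 0)"
  proof (rule AE_mp, intro AE_I2 impI)
    fix G assume G: "G \<in> space ?GL" and fin: "finite {xs. G \<in> A xs}"
    have "{xs. distinct (0 # xs) \<and> (\<forall>e\<in>path_edges (0 # xs). G e)} \<subseteq> {xs. G \<in> A xs}"
      using G by (auto simp: A_def space)
    then have "finite (component G 0)"
      by (intro finite_component_if_finitely_many_open_paths) (rule finite_subset[OF _ fin])
    then show "\<not> infinite (component G 0)" by simp
  qed
  then show ?thesis
    unfolding percolation_prob_def
    using infinite_component_measurable[of 0]
    by (subst GL.prob_eq_0) (auto simp: space sets)
qed

theorem theorem4p2:
  fixes M :: "'a measure"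
    and W :: "int ^ 'd::finite \<Rightarrow> 'a \<Rightarrow> real"
    and \<alpha> \<tau> c :: real
  assumes "prob_space M"
    and indep: "prob_space.indep_vars M (\<lambda>_. borel) W UNIV"
    and ident: "\<And>x. distr M borel (W x) = distr M borel (W 0)"
    and nonneg: "\<And>x \<omega>. \<omega> \<in> space M \<Longrightarrow> 0 \<le> W x \<omega>"
    and normalized: "integrable M (W 0) \<Longrightarrow> prob_space.expectation M (W 0) = 1"
    and "\<alpha> > real CARD('d)"
    and "\<tau> > 1" and "c > 0"
    and tail: "\<And>t. t > 0 \<Longrightarrow>
      prob_space.prob M {\<omega> \<in> space M. W 0 \<omega> > t} \<le> c * t powr (- (\<tau> - 1))"
    and "\<alpha> * (\<tau> - 1) / real CARD('d) > 2"
  shows "(\<forall>\<^sub>F l in at_right 0. percolation_prob M W \<alpha> l = 0) \<and> critical_value M W \<alpha> > 0"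
proof -
  interpret prob_space M by fact
  let ?d = "real CARD('d)"
  have d: "0 < ?d" by simp
  have "\<alpha> > 0" using d assms(6) by linarith
  \<comment> \<open>There is room for \<open>r\<close>: \<open>d / \<alpha> < 1\<close> is \<open>\<alpha> > d\<close>, and \<open>d / \<alpha> < (\<tau> - 1) / 2\<close> is the last hypothesis.\<close>
  have "?d / \<alpha> < min 1 ((\<tau> - 1) / 2)"
    using assms(6,10) \<open>\<alpha> > 0\<close> d by (auto simp: field_simps)
  then obtain r where r: "?d / \<alpha> < r" "r < min 1 ((\<tau> - 1) / 2)"
    using dense by blast
  have r': "0 < r" "r \<le> 1" "2 * r < \<tau> - 1" "?d < \<alpha> * r"
  proof -
    have "0 < ?d / \<alpha>" using d \<open>\<alpha> > 0\<close> by simp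
    with r(1) show "0 < r" by linarith
  qed (use r \<open>\<alpha> > 0\<close> in \<open>auto simp: field_simps\<close>)
  obtain Z where Z: "0 \<le> Z" "\<And>(x :: int ^ 'd) B. finite B \<Longrightarrow>
      (\<Sum>y\<in>B. lattice_dist x y powr (- (\<alpha> * r))) \<le> Z"
    using lattice_powr_sums_bounded[OF r'(4)] by blast
  have "W 0 \<in> borel_measurable M" using indep by (auto simp: indep_vars_def)
  then have "(\<integral>\<^sup>+\<omega>. ennreal (max 1 (W 0 \<omega>) powr (2 * r)) \<partial>M) < \<infinity>"
    using r' \<open>c > 0\<close>
    by (intro nn_integral_powr_finite_if_tail[where a = "\<tau> - 1" and c = c] tail) auto
  then obtain k where k: "0 \<le> k" "(\<integral>\<^sup>+\<omega>. ennreal (max 1 (W 0 \<omega>) powr (2 * r)) \<partial>M) = ennreal k"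
    by (cases "\<integral>\<^sup>+\<omega>. ennreal (max 1 (W 0 \<omega>) powr (2 * r)) \<partial>M" rule: ennreal_cases) auto
  have "((\<lambda>l. l powr r * (k * Z)) \<longlongrightarrow> 0 powr r * (k * Z)) (at_right 0)"
    using r'(1) by (intro tendsto_intros tendsto_powr') 
      (auto simp: eventually_at_right_less intro: eventually_mono[OF eventually_at_right_less])
  then have "\<forall>\<^sub>F l in at_right 0. l powr r * (k * Z) < 1"
    by (rule order_tendstoD(2)) simp
  moreover have "\<forall>\<^sub>F l in at_right 0. 0 < (l::real)" by (rule eventually_at_right_less)
  ultimately have ev: "\<forall>\<^sub>F l in at_right 0. percolation_prob M W \<alpha> l = 0"
  proof eventually_elim
    case (elim l)
    show ?case
      by (rule percolation_prob_eq_0[OF \<open>prob_space M\<close> indep ident nonneg _ r'(1,2) k Z(2)])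
        (use elim in auto)
  qed
  then obtain l0 where l0: "0 < l0" "\<And>l. 0 < l \<Longrightarrow> l < l0 \<Longrightarrow> percolation_prob M W \<alpha> l = 0"
    by (auto simp: eventually_at_right[OF zero_less_one])
  have "ereal l0 \<le> critical_value M W \<alpha>"
    unfolding critical_value_def using l0(2) by (intro Inf_greatest) (force simp: not_less[symmetric])
  then have "0 < critical_value M W \<alpha>" using l0(1) less_le_trans[of 0 "ereal l0"] by simp
  with ev show ?thesis by blast
qed

end
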